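(* Let $n\ge 2$ and let the domain of locations be $X=[0,1]$. No deterministic mechanism $f:X^n\to X$ is both strategyproof and satisfies Strong Proportionality.
   Context: Let $N=\{1,\dots,n\}$ be a set of agents, $n\ge 2$, and $X=[0,1]$. A location profile is $x=(x_1,\dots,x_n)\in X^n$, and $d(a,b)=|a-b|$. A deterministic mechanism is a map $f:X^n\to X$. The mechanism $f$ is strategyproof if for every agent $i\in N$, all $x_i,x_i'\in X$ and every profile $\hat x_{-i}$ of locations of the other agents, $d(x_i,f(x_i,\hat x_{-i}))\le d(x_i,f(x_i',\hat x_{-i}))$. The mechanism $f$ satisfies Strong Proportionality if for all $0\le\alpha<\beta\le 1$, every profile $x\in\{\alpha,\beta\}^n$ and every set $S\subseteq N$ of agents at the same location, $d(x_i,f(x))\le\frac{n-|S|}{n}(\beta-\alpha)$ for all $i\in S$. *)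

theory Defs
  imports Complex_Main "HOL-Library.FuncSet"
begin

definition agents :: "nat \<Rightarrow> nat set" where
  "agents n = {1..n}"

definition locations :: "real set" where
  "locations = {0..1}"

text \<open>Profiles are extensional functions on the agents, so that a mechanism depends only on
  the locations of the \<open>n\<close> agents, and the profiles are exactly the \<open>n\<close>-tuples.\<close>

definition profiles :: "nat \<Rightarrow> (nat \<Rightarrow> real) set" where
  "profiles n = agents n \<rightarrow>\<^sub>E locations"

definition mechanism :: "nat \<Rightarrow> ((nat \<Rightarrow> real) \<Rightarrow> real) \<Rightarrow> bool" where
  "mechanism n f \<longleftrightarrow> f \<in> profiles n \<rightarrow> locations"

text \<open>Here \<open>x\<close> is the profile in which agent \<open>i\<close> reports the true location \<open>x i\<close>, and
  \<open>x(i := y)\<close> is the one in which only agent \<open>i\<close> misreports, as \<open>y\<close>.\<close>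

definition strategyproof :: "nat \<Rightarrow> ((nat \<Rightarrow> real) \<Rightarrow> real) \<Rightarrow> bool" where
  "strategyproof n f \<longleftrightarrow>
     (\<forall>i\<in>agents n. \<forall>x\<in>profiles n. \<forall>y\<in>locations.
        dist (x i) (f x) \<le> dist (x i) (f (x(i := y))))"

definition strong_proportionality :: "nat \<Rightarrow> ((nat \<Rightarrow> real) \<Rightarrow> real) \<Rightarrow> bool" where
  "strong_proportionality n f \<longleftrightarrow>
     (\<forall>\<alpha> \<beta>. 0 \<le> \<alpha> \<and> \<alpha> < \<beta> \<and> \<beta> \<le> 1 \<longrightarrow>
        (\<forall>x \<in> agents n \<rightarrow>\<^sub>E {\<alpha>, \<beta>}. \<forall>S. S \<subseteq> agents n \<and> (\<forall>i\<in>S. \<forall>j\<in>S. x i = x j) \<longrightarrow>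
           (\<forall>i\<in>S. dist (x i) (f x) \<le> (real n - real (card S)) / real n * (\<beta> - \<alpha>))))"

end

theory Submission
  imports Defs
begin

text \<open>If all agents but one are at \<open>0\<close> and one is at \<open>b\<close>, Strong Proportionality applied to both
  groups leaves \<open>b / n\<close> as the only possible outcome. Hence an agent at \<open>1 / n\<close>, with everyone else
  at \<open>0\<close>, obtains \<open>1 / n\<^sup>2\<close> when truthful but exactly her own location \<open>1 / n\<close> by reporting \<open>1\<close>.\<close>

lemma strong_proportionality_single_agent:
  assumes "n \<ge> 2" "strong_proportionality n f" "0 < b" "b \<le> 1"
  shows "f (\<lambda>i\<in>agents n. if i = 1 then b else 0) = b / real n"
proof -
  define x where "x = (\<lambda>i\<in>agents n. if i = 1 then b else 0)"
  have x: "x \<in> agents n \<rightarrow>\<^sub>E {0, b}" "x 1 = b" "\<And>i. i \<in> {2..n} \<Longrightarrow> x i = 0"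
    using assms(1) by (auto simp: x_def agents_def)
  have proportional: "dist (x i) (f x) \<le> (real n - real (card S)) / real n * b"
    if "S \<subseteq> agents n" "\<forall>i\<in>S. \<forall>j\<in>S. x i = x j" "i \<in> S" for S i
  proof -
    have "dist (x i) (f x) \<le> (real n - real (card S)) / real n * (b - 0)"
      using assms(2-4) x(1) that unfolding strong_proportionality_def by (metis order_refl)
    then show ?thesis
      by simp
  qed
  \<comment> \<open>The group of agent \<open>1\<close> alone gives the lower bound: the outcome is
    at least \<open>b / n\<close>.\<close>
  have "dist (x 1) (f x) \<le> (real n - real (card {1::nat})) / real n * b"
    using assms(1) by (intro proportional) (auto simp: agents_def)
  then have *: "dist b (f x) \<le> (real n - 1) / real n * b"
    using x(2) by simp
  \<comment> \<open>The \<open>n - 1\<close> agents at \<open>0\<close> give the matching upper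
    bound \<open>b / n\<close>; agent \<open>2\<close> represents them, which uses
    \<open>n \<ge> 2\<close>.\<close>
  have "dist (x 2) (f x) \<le> (real n - real (card {2..n})) / real n * b"
    using assms(1) x(3) by (intro proportional) (auto simp: agents_def)
  then have "dist 0 (f x) \<le> b / real n"
    using assms(1) x(3)[of 2] by (simp add: of_nat_diff)
  \<comment> \<open>The two radii add up to \<open>b\<close>, the distance between the groups, so
    the two intervals meet only in \<open>b / n\<close>.\<close>
  moreover have "(real n - 1) / real n * b = b - b / real n"
    using assms(1) by (simp add: field_simps)
  ultimately show ?thesis
    using * unfolding x_def[symmetric] by (simp add: dist_real_def)
qed

theorem proposition1:
  fixes n :: nat
  assumes "n \<ge> 2"
  shows "\<not> (\<exists>f :: (nat \<Rightarrow> real) \<Rightarrow> real.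
            mechanism n f \<and> strategyproof n f \<and> strong_proportionality n f)"
proof
  assume "\<exists>f. mechanism n f \<and> strategyproof n f \<and> strong_proportionality n f"
  then obtain f where sp: "strategyproof n f" and proportional: "strong_proportionality n f"
    by blast
  define x where "x b = (\<lambda>i\<in>agents n. if i = 1 then b else (0::real))" for b
  have outcome: "f (x b) = b / real n" if "0 < b" "b \<le> 1" for b
    using strong_proportionality_single_agent[OF assms proportional that] by (simp add: x_def)
  have "1 \<in> agents n"
    using assms by (simp add: agents_def)
  moreover have "x (1 / real n) \<in> profiles n"
    using assms by (auto simp: x_def profiles_def locations_def)
  moreover have "(x (1 / real n))(1 := 1) = x 1" "x (1 / real n) 1 = 1 / real n"
    using \<open>1 \<in> agents n\<close> by (auto simp: x_def)
  ultimately have "dist (1 / real n) (f (x (1 / real n))) \<le> dist (1 / real n) (f (x 1))"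
    using sp unfolding strategyproof_def locations_def
    by (metis atLeastAtMost_iff order_refl zero_le_one)
  \<comment> \<open>By \<open>outcome[of 1]\<close> the misreport leaves distance \<open>0\<close>,
    so the truthful outcome must be \<open>1 / n\<close> as well, which would force
    \<open>n = 1\<close>.\<close>
  then have "1 / real n = 1 / real n / real n"
    using assms outcome[of 1] outcome[of "1 / real n"] by simp
  then show False
    using assms by (simp add: field_simps)
qed

end
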